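(* Proper Euler magic matrices exist in orders $9$, $27$, $81$ and $243$, with the following constants $\gamma$: order $9$: $\gamma=29\,322\,225=5415^2$; order $27$: $\gamma=544\,710\,422\,025=738045^2$; order $81$: $\gamma=119\,549\,586\,891\,519\,225=345759435^2$; order $243$: $\gamma=6\,755\,703\,761\,825\,804\,241\,225=82193088285^2$.
   Context: A matrix $M\in\mathbb{Z}^{n\times n}$ (indices $0,\dots,n-1$) is an Euler magic matrix of order $n$ with constant $\gamma\in\mathbb{Z}$, $\gamma\ne0$, if $MM^{\mathsf T}=\gamma I$, $\sum_{i=0}^{n-1}M_{i,i}^2=\gamma$ and $\sum_{i=0}^{n-1}M_{i,n-1-i}^2=\gamma$. It is proper if the $n^2$ entry squares $M_{i,j}^2$ are pairwise distinct. *)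

theory Defs
  imports "Jordan_Normal_Form.Matrix"
begin

(* The case n = 0 is excluded automatically, since the diagonal condition would give \<gamma> = 0. *)
definition euler_magic :: "nat \<Rightarrow> int \<Rightarrow> int mat \<Rightarrow> bool" where
  "euler_magic n \<gamma> M \<longleftrightarrow>
     M \<in> carrier_mat n n \<and> \<gamma> \<noteq> 0 \<and>
     M * transpose_mat M = \<gamma> \<cdot>\<^sub>m 1\<^sub>m n \<and>
     (\<Sum>i<n. (M $$ (i, i))\<^sup>2) = \<gamma> \<and>
     (\<Sum>i<n. (M $$ (i, n - 1 - i))\<^sup>2) = \<gamma>"

definition proper_euler_magic :: "nat \<Rightarrow> int \<Rightarrow> int mat \<Rightarrow> bool" where
  "proper_euler_magic n \<gamma> M \<longleftrightarrow>
     euler_magic n \<gamma> M \<and>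
     inj_on (\<lambda>(i, j). (M $$ (i, j))\<^sup>2) ({..<n} \<times> {..<n})"

end

theory Submission
  imports Defs
begin

text \<open>
  An integer quaternion of norm \<open>N\<close> gives an integer \<open>3 \<times> 3\<close> matrix \<open>A\<close> with
  \<open>A A\<^sup>T = N\<^sup>2 I\<close>, whose entry squares have constant row and column sums. Kronecker products of such
  matrices keep orthogonal rows. Index the rows and columns of a product of \<open>m\<close> factors by
  \<open>\<bbbF>\<^sub>3\<^sup>m\<close> and permute the columns by a linear map \<open>L\<close> such that \<open>L\<^sup>T\<close> never preserves the support of a
  nonzero vector. Expanding the squares in characters, constant row and column sums kill every
  nontrivial term, so both diagonal sums are correct for all choices of quaternions. Such \<open>L\<close> exist
  for \<open>m = 2, 3\<close>, and Kronecker products of the resulting matrices reach \<open>m = 4, 5\<close>. Only the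
  distinctness of the entries depends on the quaternions; it is read off the primes dividing them.
\<close>

section \<open>Arrays with orthogonal rows\<close>

type_synonym arr = "nat \<Rightarrow> nat \<Rightarrow> int"

definition orth_rows :: "nat \<Rightarrow> int \<Rightarrow> arr \<Rightarrow> bool" where
  "orth_rows n g A \<longleftrightarrow> (\<forall>i<n. \<forall>j<n. (\<Sum>k<n. A i k * A j k) = (if i = j then g else 0))"

definition kron :: "nat \<Rightarrow> arr \<Rightarrow> arr \<Rightarrow> arr" where
  "kron m A B i j = A (i div m) (j div m) * B (i mod m) (j mod m)"

definition vals :: "nat \<Rightarrow> arr \<Rightarrow> int set" where
  "vals n A = (\<lambda>(i, j). \<bar>A i j\<bar>) ` ({..<n} \<times> {..<n})"

text \<open>Distinct absolute values amount to distinct squares; they are multiplicative as well and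
  stay smaller, which suits factoring.\<close>

definition abs_distinct :: "nat \<Rightarrow> arr \<Rightarrow> bool" where
  "abs_distinct n A \<longleftrightarrow> inj_on (\<lambda>(i, j). \<bar>A i j\<bar>) ({..<n} \<times> {..<n})"

lemma sum_div_mod:
  fixes f :: "nat \<Rightarrow> nat \<Rightarrow> 'a::comm_monoid_add"
  assumes "0 < m"
  shows "(\<Sum>k<n * m. f (k div m) (k mod m)) = (\<Sum>i<n. \<Sum>j<m. f i j)"
proof -
  have bound: "i * m + j < n * m" if "i < n" "j < m" for i j
  proof -
    have "i * m + j < (i + 1) * m" using that by simp
    also have "\<dots> \<le> n * m" using that by (intro mult_le_mono1) simp
    finally show ?thesis .
  qed
  have "(\<Sum>i<n. \<Sum>j<m. f i j) = (\<Sum>(i, j)\<in>{..<n} \<times> {..<m}. f i j)"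
    by (rule sum.cartesian_product)
  also have "\<dots> = (\<Sum>k<n * m. f (k div m) (k mod m))"
    by (rule sum.reindex_bij_witness[where i = "\<lambda>k. (k div m, k mod m)" and j = "\<lambda>(i, j). i * m + j"])
       (use assms bound in \<open>auto simp: less_mult_imp_div_less\<close>)
  finally show ?thesis ..
qed

lemma sum_div_mod_mult:
  fixes f g :: "nat \<Rightarrow> 'a::comm_semiring_0"
  assumes "0 < m"
  shows "(\<Sum>k<n * m. f (k div m) * g (k mod m)) = (\<Sum>i<n. f i) * (\<Sum>j<m. g j)"
  using sum_div_mod[OF assms, where f = "\<lambda>i j. f i * g j"] by (simp add: sum_product)

text \<open>An inner product of two rows of a Kronecker product factors into inner products of rows
  of the factors, and two indices agree exactly when both their digits agree.\<close>

lemma orth_rows_kron: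
  assumes A: "orth_rows n g A" and B: "orth_rows m h B"
  shows "orth_rows (n * m) (g * h) (kron m A B)"
  unfolding orth_rows_def
proof (intro allI impI)
  fix i j assume ij: "i < n * m" "j < n * m"
  then have m: "0 < m" by (cases m) auto
  have d: "i div m < n" "j div m < n" "i mod m < m" "j mod m < m"
    using ij m by (auto simp: less_mult_imp_div_less)
  have "(\<Sum>k<n * m. kron m A B i k * kron m A B j k) =
      (\<Sum>k<n * m. (A (i div m) (k div m) * A (j div m) (k div m)) *
        (B (i mod m) (k mod m) * B (j mod m) (k mod m)))"
    by (simp add: kron_def mult_ac)
  also have "\<dots> = (\<Sum>k<n. A (i div m) k * A (j div m) k) * (\<Sum>k<m. B (i mod m) k * B (j mod m) k)"
    by (rule sum_div_mod_mult[OF m])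
  also have "\<dots> = (if i div m = j div m then g else 0) * (if i mod m = j mod m then h else 0)"
    using A B d by (simp add: orth_rows_def)
  also have "\<dots> = (if i = j then g * h else 0)"
    by simp (metis div_mult_mod_eq)
  finally show "(\<Sum>k<n * m. kron m A B i k * kron m A B j k) = (if i = j then g * h else 0)" .
qed

lemma orth_rows_permute_columns:
  assumes "orth_rows n g A" and "bij_betw \<sigma> {..<n} {..<n}"
  shows "orth_rows n g (\<lambda>i j. A i (\<sigma> j))"
  using assms(1) sum.reindex_bij_betw[OF assms(2), of "\<lambda>k. A i k * A j k" for i j]
  by (simp add: orth_rows_def)

lemma abs_distinct_permute_columns:
  assumes A: "abs_distinct n A" and \<sigma>: "bij_betw \<sigma> {..<n} {..<n}"
  shows "abs_distinct n (\<lambda>i j. A i (\<sigma> j))"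
  unfolding abs_distinct_def
proof (rule inj_onI, clarsimp)
  fix i j i' j'
  assume "i < n" "j < n" "i' < n" "j' < n" and eq: "\<bar>A i (\<sigma> j)\<bar> = \<bar>A i' (\<sigma> j')\<bar>"
  moreover from this have "\<sigma> j < n" "\<sigma> j' < n" using \<sigma> by (auto simp: bij_betw_def)
  ultimately have "i = i' \<and> \<sigma> j = \<sigma> j'"
    using inj_onD[OF A[unfolded abs_distinct_def], of "(i, \<sigma> j)" "(i', \<sigma> j')"] by simp
  then show "i = i' \<and> j = j'"
    using \<sigma> \<open>j < n\<close> \<open>j' < n\<close> by (auto simp: bij_betw_def dest: inj_onD)
qed

lemma vals_permute_columns:
  assumes "bij_betw \<sigma> {..<n} {..<n}"
  shows "vals n (\<lambda>i j. A i (\<sigma> j)) \<subseteq> vals n A"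
proof
  fix x assume "x \<in> vals n (\<lambda>i j. A i (\<sigma> j))"
  then obtain i j where "i < n" "j < n" "x = \<bar>A i (\<sigma> j)\<bar>" by (auto simp: vals_def)
  moreover have "\<sigma> j < n" using assms \<open>j < n\<close> by (auto simp: bij_betw_def)
  ultimately show "x \<in> vals n A" unfolding vals_def by force
qed

section \<open>Entry values of Kronecker products\<close>

definition set_mult :: "int set \<Rightarrow> int set \<Rightarrow> int set" where
  "set_mult S T = {a * b |a b. a \<in> S \<and> b \<in> T}"

definition unique_mult :: "int set \<Rightarrow> int set \<Rightarrow> bool" where
  "unique_mult S T \<longleftrightarrow>
     (\<forall>a\<in>S. \<forall>a'\<in>S. \<forall>b\<in>T. \<forall>b'\<in>T. a * b = a' * b' \<longrightarrow> a = a' \<and> b = b')"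

lemma unique_mult_mono: "unique_mult S' T' \<Longrightarrow> S \<subseteq> S' \<Longrightarrow> T \<subseteq> T' \<Longrightarrow> unique_mult S T"
  unfolding unique_mult_def by blast

lemma set_mult_mono: "S \<subseteq> S' \<Longrightarrow> T \<subseteq> T' \<Longrightarrow> set_mult S T \<subseteq> set_mult S' T'"
  unfolding set_mult_def by blast

lemma vals_kron: "vals (n * m) (kron m A B) \<subseteq> set_mult (vals n A) (vals m B)"
proof
  fix x assume "x \<in> vals (n * m) (kron m A B)"
  then obtain i j where ij: "i < n * m" "j < n * m" and
    x: "x = \<bar>A (i div m) (j div m)\<bar> * \<bar>B (i mod m) (j mod m)\<bar>"
    by (auto simp: vals_def kron_def abs_mult)
  have m: "0 < m" using ij by (cases m) auto
  have "\<bar>A (i div m) (j div m)\<bar> \<in> vals n A" "\<bar>B (i mod m) (j mod m)\<bar> \<in> vals m B"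
    using ij m less_mult_imp_div_less unfolding vals_def by force+
  with x show "x \<in> set_mult (vals n A) (vals m B)" by (auto simp: set_mult_def)
qed

text \<open>Unique factorisation recovers the entries of \<open>A\<close> and \<open>B\<close> up to
  sign from their product; distinctness within each array then recovers both digits of the row and
  column index.\<close>

lemma abs_distinct_kron:
  assumes A: "abs_distinct n A" and B: "abs_distinct m B"
    and AB: "unique_mult (vals n A) (vals m B)"
  shows "abs_distinct (n * m) (kron m A B)"
  unfolding abs_distinct_def
proof (rule inj_onI, clarsimp)
  fix i j i' j'
  assume ij: "i < n * m" "j < n * m" "i' < n * m" "j' < n * m"
    and eq: "\<bar>kron m A B i j\<bar> = \<bar>kron m A B i' j'\<bar>"
  have m: "0 < m" using ij by (cases m) auto
  note d = less_mult_imp_div_less[OF ij(1)] less_mult_imp_div_less[OF ij(2)]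
    less_mult_imp_div_less[OF ij(3)] less_mult_imp_div_less[OF ij(4)]
  have e: "i mod m < m" "j mod m < m" "i' mod m < m" "j' mod m < m" using m by auto
  have v: "\<bar>A k l\<bar> \<in> vals n A" if "k < n" "l < n" for k l
    using that unfolding vals_def by force
  have w: "\<bar>B k l\<bar> \<in> vals m B" if "k < m" "l < m" for k l
    using that unfolding vals_def by force
  have "\<bar>A (i div m) (j div m)\<bar> * \<bar>B (i mod m) (j mod m)\<bar> =
      \<bar>A (i' div m) (j' div m)\<bar> * \<bar>B (i' mod m) (j' mod m)\<bar>"
    using eq by (simp add: kron_def abs_mult)
  then have "\<bar>A (i div m) (j div m)\<bar> = \<bar>A (i' div m) (j' div m)\<bar>"
    "\<bar>B (i mod m) (j mod m)\<bar> = \<bar>B (i' mod m) (j' mod m)\<bar>"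
    using AB v[OF d(1,2)] v[OF d(3,4)] w[OF e(1,2)] w[OF e(3,4)] unfolding unique_mult_def by blast+
  then have "i div m = i' div m" "j div m = j' div m" "i mod m = i' mod m" "j mod m = j' mod m"
    using inj_onD[OF A[unfolded abs_distinct_def], of "(i div m, j div m)" "(i' div m, j' div m)"]
      inj_onD[OF B[unfolded abs_distinct_def], of "(i mod m, j mod m)" "(i' mod m, j' mod m)"] d m
    by auto
  then show "i = i' \<and> j = j'" by (metis div_mult_mod_eq)
qed

section \<open>Euler magic arrays\<close>

definition magic :: "nat \<Rightarrow> int \<Rightarrow> arr \<Rightarrow> bool" where
  "magic n g A \<longleftrightarrow> orth_rows n g A \<and> (\<Sum>i<n. (A i i)\<^sup>2) = g \<and> (\<Sum>i<n. (A i (n - 1 - i))\<^sup>2) = g"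

text \<open>Reversing an index below \<open>n * m\<close> reverses both of its digits, so the
  antidiagonal splits into digits just as the main diagonal does.\<close>

lemma magic_kron:
  assumes A: "magic n g A" and B: "magic m h B" and m: "0 < m"
  shows "magic (n * m) (g * h) (kron m A B)"
proof -
  have "(\<Sum>i<n * m. (kron m A B i i)\<^sup>2) = (\<Sum>i<n. (A i i)\<^sup>2) * (\<Sum>i<m. (B i i)\<^sup>2)"
    using sum_div_mod_mult[OF m, of "\<lambda>i. (A i i)\<^sup>2" "\<lambda>i. (B i i)\<^sup>2" n]
    by (simp add: kron_def power_mult_distrib)
  moreover have "(\<Sum>i<n * m. (kron m A B i (n * m - 1 - i))\<^sup>2) =
      (\<Sum>i<n. (A i (n - 1 - i))\<^sup>2) * (\<Sum>i<m. (B i (m - 1 - i))\<^sup>2)"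
  proof -
    have rev: "(n * m - 1 - i) div m = n - 1 - i div m \<and> (n * m - 1 - i) mod m = m - 1 - i mod m"
      if "i < n * m" for i
    proof -
      have "i div m < n" using that by (rule less_mult_imp_div_less)
      \<comment> \<open>\<open>q\<close> and \<open>r\<close> are the digits of the reversed index;
        naming them turns the truncated subtractions into additions.\<close>
      then obtain q where q: "n = Suc (i div m + q)" by (auto dest: less_imp_Suc_add)
      obtain r where r: "m = Suc (i mod m + r)"
        using mod_less_divisor[OF m, of i] less_imp_Suc_add by blast
      have "n * m = (i div m) * m + m + q * m" by (subst q) (simp add: algebra_simps)
      then have "n * m - 1 - i = q * m + r"
        using r div_mult_mod_eq[of i m] by linarith
      moreover have "r < m" using r by linarith
      moreover have "n - 1 - i div m = q" "m - 1 - i mod m = r" using q r by linarith+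
      ultimately show ?thesis by simp
    qed
    have "(\<Sum>i<n * m. (kron m A B i (n * m - 1 - i))\<^sup>2) =
        (\<Sum>i<n * m. (A (i div m) (n - 1 - i div m))\<^sup>2 * (B (i mod m) (m - 1 - i mod m))\<^sup>2)"
      by (rule sum.cong) (use rev in \<open>auto simp: kron_def power_mult_distrib\<close>)
    then show ?thesis
      using sum_div_mod_mult[OF m, of "\<lambda>i. (A i (n - 1 - i))\<^sup>2" "\<lambda>i. (B i (m - 1 - i))\<^sup>2" n] by simp
  qed
  ultimately show ?thesis
    using A B orth_rows_kron by (simp add: magic_def)
qed

lemma proper_euler_magic_mat:
  assumes "magic n g A" and "abs_distinct n A" and "g \<noteq> 0"
  shows "proper_euler_magic n g (mat n n (\<lambda>(i, j). A i j))"
proof -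
  let ?M = "mat n n (\<lambda>(i, j). A i j)"
  have "?M * transpose_mat ?M = g \<cdot>\<^sub>m 1\<^sub>m n"
    using assms(1) by (intro eq_matI) (auto simp: magic_def orth_rows_def scalar_prod_def lessThan_atLeast0)
  moreover have "inj_on (\<lambda>(i, j). (?M $$ (i, j))\<^sup>2) ({..<n} \<times> {..<n})"
    using assms(2) by (auto simp: abs_distinct_def inj_on_def power2_eq_iff abs_eq_iff)
  moreover have "(\<Sum>i<n. (?M $$ (i, i))\<^sup>2) = g" "(\<Sum>i<n. (?M $$ (i, n - 1 - i))\<^sup>2) = g"
    using assms(1) by (auto simp: magic_def)
  ultimately show ?thesis
    using assms(3) by (simp add: proper_euler_magic_def euler_magic_def)
qed

section \<open>Arrays of order 3 with constant row and column sums\<close>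

lemma lessThan_3: "{..<3::nat} = {0, 1, 2}"
  by (simp add: eval_nat_numeral lessThan_Suc insert_commute)

lemma all_less_3: "(\<forall>i<3::nat. P i) \<longleftrightarrow> P 0 \<and> P 1 \<and> P 2"
proof -
  have "(\<forall>i<3::nat. P i) \<longleftrightarrow> (\<forall>i\<in>{..<3}. P i)" by blast
  then show ?thesis unfolding lessThan_3 by simp
qed

definition row_col_sums :: "int \<Rightarrow> arr \<Rightarrow> bool" where
  "row_col_sums r a \<longleftrightarrow> (\<forall>i<3. (\<Sum>j<3. a i j) = r \<and> (\<Sum>j<3. a j i) = r)"

text \<open>The all-ones vector is a left and right eigenvector of both arrays, and its eigenvalues
  multiply under the matrix product. This merges two of the three factors in order 27.\<close>

lemma row_col_sums_compose:
  assumes "row_col_sums r a" and "row_col_sums s b"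
  shows "row_col_sums (r * s) (\<lambda>i j. \<Sum>k<3. a i k * b k j)"
proof -
  have "(\<Sum>j<3. \<Sum>k<3. a i k * b k j) = r * s" if "i < 3" for i
  proof -
    have "(\<Sum>j<3. \<Sum>k<3. a i k * b k j) = (\<Sum>k<3. a i k * (\<Sum>j<3. b k j))"
      by (subst sum.swap) (simp add: sum_distrib_left)
    also have "\<dots> = (\<Sum>k<3. a i k * s)"
      by (rule sum.cong) (use assms(2) in \<open>auto simp: row_col_sums_def\<close>)
    also have "\<dots> = r * s"
      using assms(1) that by (simp add: row_col_sums_def flip: sum_distrib_right)
    finally show ?thesis .
  qed
  moreover have "(\<Sum>i<3. \<Sum>k<3. a i k * b k j) = r * s" if "j < 3" for j
  proof -
    have "(\<Sum>i<3. \<Sum>k<3. a i k * b k j) = (\<Sum>k<3. (\<Sum>i<3. a i k) * b k j)"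
      by (subst sum.swap) (simp add: sum_distrib_right)
    also have "\<dots> = (\<Sum>k<3. r * b k j)"
      by (rule sum.cong) (use assms(1) in \<open>auto simp: row_col_sums_def\<close>)
    also have "\<dots> = r * s"
      using assms(2) that by (simp add: row_col_sums_def flip: sum_distrib_left)
    finally show ?thesis .
  qed
  ultimately show ?thesis by (simp add: row_col_sums_def)
qed

lemma row_col_sums_rev:
  assumes "row_col_sums r a"
  shows "row_col_sums r (\<lambda>i j. a i (2 - j))"
  using assms by (simp add: row_col_sums_def all_less_3 lessThan_3 add_ac numeral_2_eq_2)

text \<open>
  The two index maps are \<open>L\<close> for \<open>m = 2\<close> and its composition with the reversal of the columns. The
  case \<open>m = 3\<close> reduces to this one by summing out the digit shared by the first and third factor.
\<close>

lemma sum_affine: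
  assumes a: "row_col_sums r a" and b: "row_col_sums s b"
  shows "(\<Sum>x<3. \<Sum>y<3. a x ((x + 2 * y) mod 3) * b y ((x + y) mod 3)) = r * s" (is ?D)
    and "(\<Sum>x<3. \<Sum>y<3. a x ((2 * x + y) mod 3) * b y ((2 * x + 2 * y + 1) mod 3)) = r * s" (is ?E)
proof -
  \<comment> \<open>Constant sums leave four free entries in each array, those in rows 0, 1 and
    columns 1, 2. Expressing the others through them makes both claims polynomial
    identities.\<close>
  have sub: "a 0 0 = r - a 0 1 - a 0 2" "a 1 0 = r - a 1 1 - a 1 2"
    "a 2 0 = a 1 1 + a 1 2 + a 0 1 + a 0 2 - r"
    "a 2 1 = r - a 0 1 - a 1 1" "a 2 2 = r - a 0 2 - a 1 2"
    "b 0 0 = s - b 0 1 - b 0 2" "b 1 0 = s - b 1 1 - b 1 2"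
    "b 2 0 = b 1 1 + b 1 2 + b 0 1 + b 0 2 - s"
    "b 2 1 = s - b 0 1 - b 1 1" "b 2 2 = s - b 0 2 - b 1 2"
    using a b unfolding row_col_sums_def all_less_3 lessThan_3 by simp_all
  show ?D
    by (simp add: lessThan_3 sub flip: One_nat_def) (simp add: algebra_simps flip: One_nat_def)
  show ?E
    by (simp add: lessThan_3 sub flip: One_nat_def) (simp add: algebra_simps flip: One_nat_def)
qed

section \<open>Scaled rotation matrices of integer quaternions\<close>

text \<open>The Euler-Rodrigues matrix of the map that sends a pure quaternion v to q v q', where q
  = a + bi + cj + dk and q' is its conjugate. There is no division by the norm of q, so the entries
  stay integral.\<close>

definition rot :: "int \<Rightarrow> int \<Rightarrow> int \<Rightarrow> int \<Rightarrow> arr" where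
  "rot a b c d i j =
     [[a\<^sup>2 + b\<^sup>2 - c\<^sup>2 - d\<^sup>2, 2 * (b * c - a * d), 2 * (b * d + a * c)],
      [2 * (b * c + a * d), a\<^sup>2 - b\<^sup>2 + c\<^sup>2 - d\<^sup>2, 2 * (c * d - a * b)],
      [2 * (b * d - a * c), 2 * (c * d + a * b), a\<^sup>2 - b\<^sup>2 - c\<^sup>2 + d\<^sup>2]] ! i ! j"

lemma orth_rows_rot: "orth_rows 3 ((a\<^sup>2 + b\<^sup>2 + c\<^sup>2 + d\<^sup>2)\<^sup>2) (rot a b c d)"
  unfolding orth_rows_def all_less_3 lessThan_3
  by (simp add: rot_def) (simp add: power2_eq_square algebra_simps)

text \<open>Row sums of squares are the squared row lengths of \<open>orth_rows_rot\<close>, and the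
  columns of a multiple of an orthogonal matrix have the same length. Expansion confirms
  both.\<close>

lemma row_col_sums_rot:
  "row_col_sums ((a\<^sup>2 + b\<^sup>2 + c\<^sup>2 + d\<^sup>2)\<^sup>2) (\<lambda>i j. (rot a b c d i j)\<^sup>2)"
  unfolding row_col_sums_def all_less_3 lessThan_3
  by (simp add: rot_def) (simp add: power2_eq_square algebra_simps)

section \<open>Column-permuted Kronecker products of orders 9 and 27\<close>

text \<open>On base-3 digits this is the invertible linear map (x, y) -> (x + 2y, x + y) modulo 3.
  Its transpose changes the support of every nonzero vector.\<close>

definition shuffle9 :: "nat \<Rightarrow> nat" where
  "shuffle9 j = 3 * ((j div 3 + 2 * (j mod 3)) mod 3) + (j div 3 + j mod 3) mod 3"

definition magic9 :: "arr \<Rightarrow> arr \<Rightarrow> arr" where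
  "magic9 A B i j = kron 3 A B i (shuffle9 j)"

text \<open>On base-3 digits this is (a, b, c) -> (c, a + b, a + 2b) modulo 3, again with a
  transpose that changes all nonzero supports. Here \<open>j div 3\<close> can stand for b because
  it is 3a + b.\<close>

definition shuffle27 :: "nat \<Rightarrow> nat" where
  "shuffle27 j =
     9 * (j mod 3) + 3 * ((j div 9 + j div 3) mod 3) + (j div 9 + 2 * (j div 3)) mod 3"

definition magic27 :: "arr \<Rightarrow> arr \<Rightarrow> arr \<Rightarrow> arr" where
  "magic27 A B C i j = kron 9 A (kron 3 B C) i (shuffle27 j)"

lemma bij_shuffle9: "bij_betw shuffle9 {..<9} {..<9}"
proof -
  have "distinct (map shuffle9 [0..<9]) \<and> list_all (\<lambda>j. j < 9) (map shuffle9 [0..<9])"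
    by (simp add: shuffle9_def upt_rec)
  then have "inj_on shuffle9 {..<9}" "shuffle9 ` {..<9} \<subseteq> {..<9}"
    by (auto simp: distinct_map list_all_iff lessThan_atLeast0)
  then show ?thesis
    by (simp add: bij_betw_def endo_inj_surj)
qed

lemma bij_shuffle27: "bij_betw shuffle27 {..<27} {..<27}"
proof -
  have "distinct (map shuffle27 [0..<27]) \<and> list_all (\<lambda>j. j < 27) (map shuffle27 [0..<27])"
    by (simp add: shuffle27_def upt_rec)
  then have "inj_on shuffle27 {..<27}" "shuffle27 ` {..<27} \<subseteq> {..<27}"
    by (auto simp: distinct_map list_all_iff lessThan_atLeast0)
  then show ?thesis
    by (simp add: bij_betw_def endo_inj_surj)
qed

lemma sum_mult:
  fixes f :: "nat \<Rightarrow> 'a::comm_monoid_add"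
  assumes "0 < m"
  shows "(\<Sum>k<n * m. f k) = (\<Sum>i<n. \<Sum>j<m. f (i * m + j))"
  using sum_div_mod[OF assms, of "\<lambda>i j. f (i * m + j)" n] by simp

lemma sum_9: "(\<Sum>i<9. f i) = (\<Sum>x<3. \<Sum>y<3. f (3 * x + y))" for f :: "nat \<Rightarrow> int"
  using sum_mult[of 3 f 3] by (simp add: mult.commute)

lemma sum_27: "(\<Sum>i<27. f i) = (\<Sum>x<3. \<Sum>y<3. \<Sum>z<3. f (9 * x + 3 * y + z))" for f :: "nat \<Rightarrow> int"
  using sum_mult[of 9 f 3] by (simp add: sum_9 ac_simps)

text \<open>Written in digits, the main diagonal becomes the first sum of \<open>sum_affine\<close>
  and the antidiagonal the second, both for the squared entries.\<close>

lemma magic_magic9: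
  assumes A: "orth_rows 3 r A" "row_col_sums r (\<lambda>i j. (A i j)\<^sup>2)"
    and B: "orth_rows 3 s B" "row_col_sums s (\<lambda>i j. (B i j)\<^sup>2)"
  shows "magic 9 (r * s) (magic9 A B)"
proof -
  have "orth_rows 9 (r * s) (magic9 A B)"
    using orth_rows_permute_columns[OF orth_rows_kron[OF A(1) B(1)], of shuffle9] bij_shuffle9
    by (simp add: magic9_def[abs_def])
  moreover have "(\<Sum>i<9. (magic9 A B i i)\<^sup>2) = r * s"
    unfolding sum_affine(1)[OF A(2) B(2), symmetric] sum_9
    by (simp add: lessThan_3 magic9_def kron_def shuffle9_def power_mult_distrib flip: One_nat_def)
  moreover have "(\<Sum>i<9. (magic9 A B i (9 - 1 - i))\<^sup>2) = r * s"
    unfolding sum_affine(2)[OF A(2) B(2), symmetric] sum_9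
    by (simp add: lessThan_3 magic9_def kron_def shuffle9_def power_mult_distrib flip: One_nat_def)
  ultimately show ?thesis unfolding magic_def by blast
qed

lemma digits27:
  fixes x y z :: nat
  assumes "y < 3" "z < 3"
  shows "(9 * x + 3 * y + z) div 9 = x" "(9 * x + 3 * y + z) mod 9 = 3 * y + z"
    "(9 * x + 3 * y + z) div 3 = 3 * x + y" "(9 * x + 3 * y + z) mod 3 = z"
    "(3 * y + z) div 3 = y" "(3 * y + z) mod 3 = z"
proof -
  have "3 * y + z < 9" using assms by linarith
  then show "(9 * x + 3 * y + z) div 9 = x" "(9 * x + 3 * y + z) mod 9 = 3 * y + z"
    unfolding add.assoc by simp_all
  have "9 * x + 3 * y + z = 3 * (3 * x + y) + z" by simp
  then show "(9 * x + 3 * y + z) div 3 = 3 * x + y" "(9 * x + 3 * y + z) mod 3 = z"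
    using assms(2) by (simp_all only: div_mult_self4 mod_mult_self4) simp_all
qed (use assms in simp_all)

lemma magic27_digits:
  assumes "x < 3" "y < 3" "z < 3" "a < 3" "b < 3" "c < 3"
  shows "magic27 A B C (9 * x + 3 * y + z) (9 * a + 3 * b + c) =
    A x c * B y ((a + b) mod 3) * C z ((a + 2 * b) mod 3)"
proof -
  have "shuffle27 (9 * a + 3 * b + c) = 9 * c + 3 * ((a + b) mod 3) + (a + 2 * b) mod 3"
  proof -
    have "a + (3 * a + b) = (a + b) + 3 * a" "a + 2 * (3 * a + b) = (a + 2 * b) + 3 * (2 * a)"
      by simp_all
    then show ?thesis
      unfolding shuffle27_def digits27[OF assms(5,6)] by (simp only: mod_mult_self2)
  qed
  then show ?thesis
    by (simp add: magic27_def kron_def digits27 assms mult.assoc)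
qed

lemma magic_magic27:
  assumes A: "orth_rows 3 r A" "row_col_sums r (\<lambda>i j. (A i j)\<^sup>2)"
    and B: "orth_rows 3 s B" "row_col_sums s (\<lambda>i j. (B i j)\<^sup>2)"
    and C: "orth_rows 3 t C" "row_col_sums t (\<lambda>i j. (C i j)\<^sup>2)"
  shows "magic 27 (r * (s * t)) (magic27 A B C)"
proof -
  have "orth_rows 27 (r * (s * t)) (magic27 A B C)"
    using orth_rows_permute_columns[OF orth_rows_kron[OF A(1) orth_rows_kron[OF B(1) C(1)]], of shuffle27]
      bij_shuffle27
    by (simp add: magic27_def[abs_def])
  moreover have "(\<Sum>i<27. (magic27 A B C i i)\<^sup>2) = r * (s * t)"
  proof -
    have "(\<Sum>i<27. (magic27 A B C i i)\<^sup>2) =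
        (\<Sum>x<3. \<Sum>y<3. \<Sum>z<3. (A x z * B y ((x + y) mod 3) * C z ((x + 2 * y) mod 3))\<^sup>2)"
      unfolding sum_27 by (intro sum.cong refl) (simp add: magic27_digits)
    \<comment> \<open>\<open>z\<close> occurs only in \<open>A\<close> and \<open>C\<close>. Summing
      it out multiplies their arrays of squares, and \<open>sum_affine\<close> applies to that
      product and \<open>B\<close>.\<close>
    also have "\<dots> = r * t * s"
      unfolding sum_affine(1)[OF row_col_sums_compose[OF A(2) C(2)] B(2), symmetric]
      by (intro sum.cong refl) (simp add: power_mult_distrib sum_distrib_left mult_ac)
    finally show ?thesis by (simp add: mult_ac)
  qed
  moreover have "(\<Sum>i<27. (magic27 A B C i (27 - 1 - i))\<^sup>2) = r * (s * t)"
  proof -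
    \<comment> \<open>Truncated subtraction makes this true for every \<open>k\<close>; it
      discharges the range conditions on the reversed digits.\<close>
    have two: "2 - k < 3" for k :: nat by linarith
    have rev: "27 - 1 - (9 * x + 3 * y + z) = 9 * (2 - x) + 3 * (2 - y) + (2 - z)"
      "(2 - x + (2 - y)) mod 3 = (2 * x + 2 * y + 1) mod 3"
      "(2 - x + 2 * (2 - y)) mod 3 = (2 * x + y) mod 3"
      if "x < 3" "y < 3" "z < 3" for x y z :: nat
    proof -
      show "27 - 1 - (9 * x + 3 * y + z) = 9 * (2 - x) + 3 * (2 - y) + (2 - z)"
        using that by linarith
      have "\<forall>x<3. \<forall>y<3. (2 - x + (2 - y)) mod 3 = (2 * x + 2 * y + 1 :: nat) mod 3 \<and>
          (2 - x + 2 * (2 - y)) mod 3 = (2 * x + y) mod 3"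
        by (simp add: all_less_3)
      then show "(2 - x + (2 - y)) mod 3 = (2 * x + 2 * y + 1) mod 3"
        "(2 - x + 2 * (2 - y)) mod 3 = (2 * x + y) mod 3"
        using that by blast+
    qed
    have "(\<Sum>i<27. (magic27 A B C i (27 - 1 - i))\<^sup>2) =
        (\<Sum>x<3. \<Sum>y<3. \<Sum>z<3. (A x (2 - z) * B y ((2 * x + 2 * y + 1) mod 3) * C z ((2 * x + y) mod 3))\<^sup>2)"
      unfolding sum_27 by (intro sum.cong refl) (simp only: lessThan_iff two rev magic27_digits)
    \<comment> \<open>The index \<open>2 - z\<close> reverses the columns of \<open>A\<close>, so
      the product with \<open>C\<close> is formed from the reversed array.\<close>
    also have "\<dots> = r * t * s"
      unfolding sum_affine(2)[OF row_col_sums_compose[OF row_col_sums_rev[OF A(2)] C(2)] B(2), symmetric]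
      by (intro sum.cong refl) (simp add: power_mult_distrib sum_distrib_left mult_ac)
    finally show ?thesis by (simp add: mult_ac)
  qed
  ultimately show ?thesis unfolding magic_def by blast
qed

section \<open>Unique factorisation in products of finite sets\<close>

text \<open>A list, so that repetitions count and the values can be evaluated.\<close>

definition entries :: "nat \<Rightarrow> arr \<Rightarrow> int list" where
  "entries n A = map (\<lambda>(i, j). \<bar>A i j\<bar>) (List.product [0..<n] [0..<n])"

lemma set_entries: "set (entries n A) = vals n A"
  by (simp add: entries_def vals_def lessThan_atLeast0)

lemma abs_distinct_entries: "distinct (entries n A) \<Longrightarrow> abs_distinct n A"
  by (simp add: entries_def abs_distinct_def distinct_map lessThan_atLeast0)

text \<open>The analogue of \<open>unique_mult\<close> for any number of factors.\<close>

definition uniq :: "int set list \<Rightarrow> bool" where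
  "uniq Ss \<longleftrightarrow> (\<forall>xs ys. list_all2 (\<in>) xs Ss \<and> list_all2 (\<in>) ys Ss \<and> prod_list xs = prod_list ys \<longrightarrow> xs = ys)"

definition prods :: "int set list \<Rightarrow> int set" where
  "prods Ss = {prod_list xs |xs. list_all2 (\<in>) xs Ss}"

lemma prods_single: "prods [S] = S"
proof -
  have "x \<in> prods [S]" if "x \<in> S" for x
    using that unfolding prods_def by (intro CollectI exI[of _ "[x]"]) simp
  then show ?thesis by (auto simp: prods_def list_all2_Cons2)
qed

lemma prods_append: "prods (Ss @ Ts) = set_mult (prods Ss) (prods Ts)"
proof (intro equalityI subsetI)
  fix x assume "x \<in> prods (Ss @ Ts)"
  then obtain us vs where "x = prod_list (us @ vs)" "list_all2 (\<in>) us Ss" "list_all2 (\<in>) vs Ts"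
    by (auto simp: prods_def list_all2_append2)
  then show "x \<in> set_mult (prods Ss) (prods Ts)"
    unfolding prods_def set_mult_def by auto
next
  fix x assume "x \<in> set_mult (prods Ss) (prods Ts)"
  then obtain us vs where "x = prod_list (us @ vs)" "list_all2 (\<in>) us Ss" "list_all2 (\<in>) vs Ts"
    by (auto simp: prods_def set_mult_def)
  then show "x \<in> prods (Ss @ Ts)"
    unfolding prods_def by (blast intro: list_all2_appendI)
qed

text \<open>Choices from the two blocks concatenate to one choice, and equal lengths split the
  resulting list equation again.\<close>

lemma unique_mult_prods:
  assumes "uniq (Ss @ Ts)"
  shows "unique_mult (prods Ss) (prods Ts)"
  unfolding unique_mult_def
proof (intro ballI impI)
  fix a a' b b'
  assume "a \<in> prods Ss" "a' \<in> prods Ss" "b \<in> prods Ts" "b' \<in> prods Ts" and eq: "a * b = a' * b'"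
  then obtain xs xs' ys ys' where
    l: "list_all2 (\<in>) xs Ss" "list_all2 (\<in>) xs' Ss" "list_all2 (\<in>) ys Ts" "list_all2 (\<in>) ys' Ts"
    and p: "a = prod_list xs" "a' = prod_list xs'" "b = prod_list ys" "b' = prod_list ys'"
    unfolding prods_def by blast
  have "xs @ ys = xs' @ ys'"
    using assms eq l list_all2_appendI unfolding uniq_def p by (metis prod_list.append)
  moreover have "length xs = length xs'" using l by (metis list_all2_lengthD)
  ultimately show "a = a' \<and> b = b'" using p by simp
qed

text \<open>Padding two choices from one block by a fixed choice from the other keeps their products
  equal; nonempty sets supply the padding.\<close>

lemma uniq_appendD:
  assumes "uniq (Ss @ Ts)" and "\<forall>S\<in>set (Ss @ Ts). S \<noteq> {}"
  shows "uniq Ss" "uniq Ts"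
proof -
  have ne: "\<exists>xs. list_all2 (\<in>) xs Us" if "\<forall>S\<in>set Us. S \<noteq> {}" for Us :: "int set list"
    using that by (induction Us) (auto simp: list_all2_Cons2)
  obtain us vs where us: "list_all2 (\<in>) us Ss" and vs: "list_all2 (\<in>) vs Ts"
    using ne[of Ss] ne[of Ts] assms(2) by auto
  show "uniq Ss"
    unfolding uniq_def
  proof (intro allI impI, elim conjE)
    fix xs ys assume "list_all2 (\<in>) xs Ss" "list_all2 (\<in>) ys Ss" "prod_list xs = prod_list ys"
    then have "xs @ vs = ys @ vs"
      using assms(1) vs list_all2_appendI unfolding uniq_def by (metis prod_list.append)
    then show "xs = ys" by simp
  qed
  show "uniq Ts"
    unfolding uniq_def
  proof (intro allI impI, elim conjE)
    fix xs ys assume "list_all2 (\<in>) xs Ts" "list_all2 (\<in>) ys Ts" "prod_list xs = prod_list ys"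
    then have "us @ xs = us @ ys"
      using assms(1) us list_all2_appendI unfolding uniq_def by (metis prod_list.append)
    then show "xs = ys" by simp
  qed
qed

text \<open>
  If \<open>Q\<close> is coprime to all other factors of a product, then the product determines the gcd of the
  factor from \<open>S\<close> with \<open>Q\<close>. Only pairs agreeing there can be exchanged between two equal products;
  the pair \<open>(1, 1)\<close> stands for all equal pairs at once.
\<close>

definition clashes :: "int list \<Rightarrow> int \<Rightarrow> (int \<times> int) list" where
  "clashes S Q = (1, 1) # filter (\<lambda>(a, b). a \<noteq> b \<and> gcd a Q = gcd b Q) (List.product S S)"

text \<open>An exhaustive search over one pair from each list. \<open>u\<close> and \<open>v\<close>
  carry the products of the first and second components, and \<open>t\<close> records whether all
  pairs so far had equal components.\<close>

fun no_clash :: "(int \<times> int) list list \<Rightarrow> int \<Rightarrow> int \<Rightarrow> bool \<Rightarrow> bool" where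
  "no_clash [] u v t \<longleftrightarrow> (u = v \<longrightarrow> t)"
| "no_clash (R # Rs) u v t \<longleftrightarrow> (\<forall>(p, q)\<in>set R. no_clash Rs (u * p) (v * q) (t \<and> p = q))"

lemma no_clashD:
  assumes "no_clash Rs u v t" and "list_all2 (\<lambda>pq R. pq \<in> set R) pqs Rs"
    and "u * prod_list (map fst pqs) = v * prod_list (map snd pqs)"
  shows "t \<and> map fst pqs = map snd pqs"
  using assms
proof (induction Rs arbitrary: u v t pqs)
  case (Cons R Rs)
  from Cons.prems(2) obtain p q pqs' where pqs: "pqs = (p, q) # pqs'" and R: "(p, q) \<in> set R"
    and l: "list_all2 (\<lambda>pq R. pq \<in> set R) pqs' Rs"
    by (auto simp: list_all2_Cons2)
  have "(t \<and> p = q) \<and> map fst pqs' = map snd pqs'"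
    by (rule Cons.IH[OF _ l]) (use Cons.prems R pqs in \<open>auto simp: mult.assoc\<close>)
  then show ?case using pqs by simp
qed simp

lemma prod_list_nth_split:
  fixes xs :: "'a::comm_monoid_mult list"
  assumes "i < length xs"
  shows "prod_list xs = xs ! i * prod_list (take i xs @ drop (Suc i) xs)"
  using assms by (subst id_take_nth_drop[OF assms]) (simp add: mult_ac)

text \<open>Equal products force equal gcds with \<open>Q\<close> at every position, since
  \<open>Q\<close> is coprime to the factors elsewhere. Replacing agreeing pairs by
  \<open>(1, 1)\<close> cancels nonzero common factors, so the new pairs lie in
  \<open>clashes\<close> and still have equal products; \<open>no_clash\<close> then excludes any
  disagreement.\<close>

lemma uniqI:
  fixes ts :: "(int list \<times> int) list"
  assumes cop: "sorted_wrt (\<lambda>(S, Q) (S', Q'). (\<forall>x\<in>set S. coprime x Q') \<and> (\<forall>x\<in>set S'. coprime x Q)) ts"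
    and nz: "\<forall>(S, Q)\<in>set ts. 0 \<notin> set S"
    and nc: "no_clash (map (\<lambda>(S, Q). clashes S Q) ts) 1 1 True"
  shows "uniq (map (\<lambda>(S, Q). set S) ts)"
  unfolding uniq_def
proof (intro allI impI, elim conjE)
  fix xs ys
  assume x: "list_all2 (\<in>) xs (map (\<lambda>(S, Q). set S) ts)"
    and y: "list_all2 (\<in>) ys (map (\<lambda>(S, Q). set S) ts)"
    and eq: "prod_list xs = prod_list ys"
  define S where "S i = fst (ts ! i)" for i
  define Q where "Q i = snd (ts ! i)" for i
  have ts: "ts ! i = (S i, Q i)" for i by (simp add: S_def Q_def)
  have len: "length xs = length ts" "length ys = length ts"
    using x y by (auto dest: list_all2_lengthD)
  have mem: "xs ! i \<in> set (S i)" "ys ! i \<in> set (S i)" if "i < length ts" for i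
    using that x y len ts by (auto simp: list_all2_conv_all_nth)
  have coprime: "coprime a (Q i)" if "i < length ts" "j < length ts" "i \<noteq> j" "a \<in> set (S j)" for i j a
    using cop that ts by (cases i j rule: linorder_cases) (fastforce simp: sorted_wrt_iff_nth_less)+
  have rest: "coprime (prod_list (take i zs @ drop (Suc i) zs)) (Q i)"
    if i: "i < length ts" and l: "length zs = length ts" and z: "\<And>j. j < length ts \<Longrightarrow> zs ! j \<in> set (S j)" for i zs
  proof -
    have "coprime a (Q i)" if "a \<in> set (take i zs @ drop (Suc i) zs)" for a
    proof -
      from that consider j where "j < i" "a = zs ! j" | j where "j < length ts - Suc i" "a = zs ! (Suc i + j)"
        using l i by (auto simp: in_set_conv_nth)
      then obtain j where "j < length ts" "j \<noteq> i" "a = zs ! j"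
      proof cases
        case 1
        then show thesis using i by (intro that[of j]) auto
      next
        case 2
        then show thesis using i by (intro that[of "Suc i + j"]) auto
      qed
      then show ?thesis using coprime[OF i] z by metis
    qed
    moreover have "coprime (prod_list ws) (Q i)" if "\<And>a. a \<in> set ws \<Longrightarrow> coprime a (Q i)" for ws
      using that by (induction ws) auto
    ultimately show ?thesis by blast
  qed
  have gcd: "gcd (xs ! i) (Q i) = gcd (ys ! i) (Q i)" if i: "i < length ts" for i
  proof -
    have "gcd (prod_list zs) (Q i) = gcd (zs ! i) (Q i)"
      if "length zs = length ts" "\<And>j. j < length ts \<Longrightarrow> zs ! j \<in> set (S j)" for zs
      unfolding prod_list_nth_split[of i zs, unfolded that(1), OF i]
      by (rule gcd_mult_left_right_cancel) (use rest[OF i that] in \<open>simp add: coprime_commute\<close>)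
    then show ?thesis using mem len eq by metis
  qed
  define pq where "pq i = (if xs ! i = ys ! i then (1, 1) else (xs ! i, ys ! i))" for i
  have "pq i \<in> set (clashes (S i) (Q i))" if "i < length ts" for i
    using that mem gcd by (auto simp: pq_def clashes_def)
  then have l: "list_all2 (\<lambda>pq R. pq \<in> set R) (map pq [0..<length ts]) (map (\<lambda>(S, Q). clashes S Q) ts)"
    using ts by (auto simp: list_all2_conv_all_nth)
  \<comment> \<open>Cross-multiplication avoids division: taken over all positions, it lets the
    common nonzero product of \<open>xs\<close> and \<open>ys\<close> cancel.\<close>
  have cross: "xs ! i * snd (pq i) = ys ! i * fst (pq i)" for i by (simp add: pq_def)
  have prod: "prod_list zs = (\<Prod>i<length ts. zs ! i)" if "length zs = length ts" for zs :: "int list"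
    using that by (simp add: prod.list_conv_set_nth lessThan_atLeast0)
  have "(\<Prod>i<length ts. xs ! i) * (\<Prod>i<length ts. snd (pq i)) = (\<Prod>i<length ts. ys ! i) * (\<Prod>i<length ts. fst (pq i))"
    by (simp add: cross flip: prod.distrib)
  moreover have "(\<Prod>i<length ts. xs ! i) = (\<Prod>i<length ts. ys ! i)"
    using eq prod len by simp
  moreover have "(\<Prod>i<length ts. ys ! i) \<noteq> 0"
  proof -
    have "ys ! i \<noteq> 0" if i: "i < length ts" for i
    proof -
      have "(S i, Q i) \<in> set ts" using nth_mem[OF i] ts by simp
      with nz have "0 \<notin> set (S i)" by blast
      with mem(2)[OF i] show ?thesis by metis
    qed
    then show ?thesis by simp
  qed
  ultimately have "(\<Prod>i<length ts. fst (pq i)) = (\<Prod>i<length ts. snd (pq i))" by simp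
  then have "map fst (map pq [0..<length ts]) = map snd (map pq [0..<length ts])"
    using no_clashD[OF nc l] by (simp add: prod.list_conv_set_nth lessThan_atLeast0)
  then have "fst (pq i) = snd (pq i)" if "i < length ts" for i using that by simp
  moreover have "xs ! i = ys ! i" if "fst (pq i) = snd (pq i)" for i
    using that by (simp add: pq_def split: if_splits)
  ultimately have "xs ! i = ys ! i" if "i < length ts" for i
    using that by blast
  then show "xs = ys" using len by (simp add: nth_equalityI)
qed

section \<open>The matrices\<close>

lemmas entries_simps = entries_def rot_def upt_rec
lemma entries_1_3_5_6: "entries 3 (rot 1 3 5 6) = [51, 18, 46, 42, 19, 54, 26, 66, 3]"
  by (simp add: entries_simps)
lemma entries_1_3_5_8: "entries 3 (rot 1 3 5 8) = [79, 14, 58, 46, 47, 74, 38, 86, 31]"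
  by (simp add: entries_simps)
lemma entries_2_4_6_7: "entries 3 (rot 2 4 6 7) = [65, 20, 80, 76, 25, 68, 32, 100, 1]"
  by (simp add: entries_simps)
text \<open>Each second component is a product of prime powers whose primes divide entries of that matrix only.\<close>

lemma uniq_27: "uniq [vals 3 (rot 1 3 5 6), vals 3 (rot 1 3 5 8), vals 3 (rot 2 4 6 7)]"
proof -
  \<comment> \<open>Here 297 = 3^3 * 11 and 5310737317 = 29 * 31 * 37 * 43 * 47 * 79. Primes shared
    between matrices, such as 13, 17 and 19, are left out.\<close>
  let ?ts = "[(entries 3 (rot 1 3 5 6), 297),
      (entries 3 (rot 1 3 5 8), 5310737317),
      (entries 3 (rot 2 4 6 7), 25)] :: (int list \<times> int) list"
  have "sorted_wrt (\<lambda>(S, Q) (S', Q'). (\<forall>x\<in>set S. coprime x Q') \<and> (\<forall>x\<in>set S'. coprime x Q)) ?ts"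
    unfolding entries_1_3_5_6 entries_1_3_5_8 entries_2_4_6_7 by code_simp
  moreover have "\<forall>(S, Q)\<in>set ?ts. 0 \<notin> set S"
    by (simp add: entries_1_3_5_6 entries_1_3_5_8 entries_2_4_6_7)
  moreover have "no_clash (map (\<lambda>(S, Q). clashes S Q) ?ts) 1 1 True"
    unfolding entries_1_3_5_6 entries_1_3_5_8 entries_2_4_6_7 by code_simp
  ultimately show ?thesis
    using uniqI[of ?ts] by (simp add: set_entries)
qed
lemma entries_1_2_6_8: "entries 3 (rot 1 2 6 8) = [95, 8, 44, 40, 31, 92, 20, 100, 25]"
  by (simp add: entries_simps)
lemma entries_3_4_5_9: "entries 3 (rot 3 4 5 9) = [81, 14, 102, 94, 63, 66, 42, 114, 49]"
  by (simp add: entries_simps)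
lemma entries_1_3_4_11: "entries 3 (rot 1 3 4 11) = [127, 2, 74, 46, 113, 82, 58, 94, 97]"
  by (simp add: entries_simps)
lemma entries_3_4_5_11: "entries 3 (rot 3 4 5 11) = [121, 26, 118, 106, 103, 86, 58, 134, 89]"
  by (simp add: entries_simps)
lemma uniq_81:
  "uniq [vals 3 (rot 1 2 6 8), vals 3 (rot 3 4 5 9), vals 3 (rot 1 3 4 11), vals 3 (rot 3 4 5 11)]"
proof -
  \<comment> \<open>Here 775 = 5^2 * 31, 7497 = 3^2 * 7^2 * 17, and the other two are products of
    distinct primes. The primes 2, 11, 19, 23, 29 and 47 are shared between matrices and left
    out.\<close>
  let ?ts = "[(entries 3 (rot 1 2 6 8), 775),
      (entries 3 (rot 3 4 5 9), 7497),
      (entries 3 (rot 1 3 4 11), 2111735299),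
      (entries 3 (rot 3 4 5 11), 1073598072677)] :: (int list \<times> int) list"
  have "sorted_wrt (\<lambda>(S, Q) (S', Q'). (\<forall>x\<in>set S. coprime x Q') \<and> (\<forall>x\<in>set S'. coprime x Q)) ?ts"
    unfolding entries_1_2_6_8 entries_3_4_5_9 entries_1_3_4_11 entries_3_4_5_11 by code_simp
  moreover have "\<forall>(S, Q)\<in>set ?ts. 0 \<notin> set S"
    by (simp add: entries_1_2_6_8 entries_3_4_5_9 entries_1_3_4_11 entries_3_4_5_11)
  moreover have "no_clash (map (\<lambda>(S, Q). clashes S Q) ?ts) 1 1 True"
    unfolding entries_1_2_6_8 entries_3_4_5_9 entries_1_3_4_11 entries_3_4_5_11 by code_simp
  ultimately show ?thesis
    using uniqI[of ?ts] by (simp add: set_entries)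
qed
lemma entries_1_2_4_6: "entries 3 (rot 1 2 4 6) = [47, 4, 32, 28, 23, 44, 16, 52, 17]"
  by (simp add: entries_simps)
lemma entries_1_3_6_7: "entries 3 (rot 1 3 6 7) = [75, 22, 54, 50, 21, 78, 30, 90, 5]"
  by (simp add: entries_simps)
lemma entries_3_5_7_8: "entries 3 (rot 3 5 7 8) = [79, 22, 122, 118, 31, 82, 38, 142, 1]"
  by (simp add: entries_simps)
lemma entries_1_3_5_14: "entries 3 (rot 1 3 5 14) = [211, 2, 94, 58, 179, 134, 74, 146, 163]"
  by (simp add: entries_simps)
lemma entries_1_9_13_14: "entries 3 (rot 1 9 13 14) = [283, 206, 278, 262, 107, 346, 226, 382, 53]"
  by (simp add: entries_simps)
text \<open>The gcds separate all entries of the fifth matrix. They confuse only 21 with 78 in the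
  second, 22 with 1 in the third, 2 with 94 in the fourth, and the seven entries coprime to 391 in
  the first, so the remaining search is short.\<close>

lemma uniq_243:
  "uniq [vals 3 (rot 1 2 4 6), vals 3 (rot 1 3 6 7), vals 3 (rot 3 5 7 8),
    vals 3 (rot 1 3 5 14), vals 3 (rot 1 9 13 14)]"
proof -
  let ?ts = "[(entries 3 (rot 1 2 4 6), 391),
      (entries 3 (rot 1 3 6 7), 225),
      (entries 3 (rot 3 5 7 8), 487490815859),
      (entries 3 (rot 1 3 5 14), 32308773778921),
      (entries 3 (rot 1 9 13 14), 212056430957392733)] :: (int list \<times> int) list"
  have "sorted_wrt (\<lambda>(S, Q) (S', Q'). (\<forall>x\<in>set S. coprime x Q') \<and> (\<forall>x\<in>set S'. coprime x Q)) ?ts"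
    unfolding entries_1_2_4_6 entries_1_3_6_7 entries_3_5_7_8 entries_1_3_5_14 entries_1_9_13_14 by code_simp
  moreover have "\<forall>(S, Q)\<in>set ?ts. 0 \<notin> set S"
    by (simp add: entries_1_2_4_6 entries_1_3_6_7 entries_3_5_7_8 entries_1_3_5_14 entries_1_9_13_14)
  moreover have "no_clash (map (\<lambda>(S, Q). clashes S Q) ?ts) 1 1 True"
    unfolding entries_1_2_4_6 entries_1_3_6_7 entries_3_5_7_8 entries_1_3_5_14 entries_1_9_13_14 by code_simp
  ultimately show ?thesis
    using uniqI[of ?ts] by (simp add: set_entries)
qed

section \<open>Distinctness of the entries and the four orders\<close>

lemma vals_nonempty: "vals 3 A \<noteq> {}"
  by (auto simp: vals_def lessThan_3)

lemma vals_magic9: "vals 9 (magic9 A B) \<subseteq> prods [vals 3 A, vals 3 B]"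
proof -
  have "vals 9 (magic9 A B) \<subseteq> vals (3 * 3) (kron 3 A B)"
    using vals_permute_columns[OF bij_shuffle9, of "kron 3 A B"] by (simp add: magic9_def[abs_def])
  also have "\<dots> \<subseteq> set_mult (vals 3 A) (vals 3 B)"
    by (rule vals_kron)
  finally show ?thesis
    using prods_append[of "[vals 3 A]" "[vals 3 B]"] by (simp add: prods_single)
qed

lemma abs_distinct_magic9:
  assumes "abs_distinct 3 A" "abs_distinct 3 B" and "uniq [vals 3 A, vals 3 B]"
  shows "abs_distinct 9 (magic9 A B)"
proof -
  have "unique_mult (vals 3 A) (vals 3 B)"
    using unique_mult_prods[of "[vals 3 A]" "[vals 3 B]"] assms(3) by (simp add: prods_single)
  then have "abs_distinct 9 (kron 3 A B)"
    using abs_distinct_kron[OF assms(1,2)] by simp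
  then show ?thesis
    using abs_distinct_permute_columns[OF _ bij_shuffle9] by (simp add: magic9_def[abs_def])
qed

lemma vals_magic27: "vals 27 (magic27 A B C) \<subseteq> prods [vals 3 A, vals 3 B, vals 3 C]"
proof -
  have "vals 27 (magic27 A B C) \<subseteq> vals (3 * (3 * 3)) (kron (3 * 3) A (kron 3 B C))"
    using vals_permute_columns[OF bij_shuffle27, of "kron 9 A (kron 3 B C)"]
    by (simp add: magic27_def[abs_def])
  also have "\<dots> \<subseteq> set_mult (vals 3 A) (vals (3 * 3) (kron 3 B C))"
    by (rule vals_kron)
  also have "\<dots> \<subseteq> set_mult (vals 3 A) (set_mult (vals 3 B) (vals 3 C))"
    by (intro set_mult_mono vals_kron order_refl)
  finally show ?thesis
    using prods_append[of "[vals 3 A]" "[vals 3 B, vals 3 C]"] prods_append[of "[vals 3 B]" "[vals 3 C]"]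
    by (simp add: prods_single)
qed

text \<open>Uniqueness for the triple serves twice: its tail separates the entries of the product of
  \<open>B\<close> and \<open>C\<close>, and its split after the first set separates
  \<open>A\<close> from that product.\<close>

lemma abs_distinct_magic27:
  assumes "abs_distinct 3 A" "abs_distinct 3 B" "abs_distinct 3 C"
    and uniq: "uniq [vals 3 A, vals 3 B, vals 3 C]"
  shows "abs_distinct 27 (magic27 A B C)"
proof -
  have "uniq ([vals 3 B] @ [vals 3 C])"
    using uniq_appendD(2)[of "[vals 3 A]" "[vals 3 B, vals 3 C]"] uniq by (simp add: vals_nonempty)
  from unique_mult_prods[OF this] have BC: "abs_distinct (3 * 3) (kron 3 B C)"
    using abs_distinct_kron[OF assms(2,3)] by (simp add: prods_single)
  have "unique_mult (vals 3 A) (prods [vals 3 B, vals 3 C])"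
    using unique_mult_prods[of "[vals 3 A]" "[vals 3 B, vals 3 C]"] uniq by (simp add: prods_single)
  moreover have "vals (3 * 3) (kron 3 B C) \<subseteq> prods [vals 3 B, vals 3 C]"
    using vals_kron[of 3 3 B C] prods_append[of "[vals 3 B]" "[vals 3 C]"] by (simp add: prods_single)
  ultimately have "unique_mult (vals 3 A) (vals (3 * 3) (kron 3 B C))"
    by (rule unique_mult_mono[OF _ order_refl])
  then have "abs_distinct 27 (kron 9 A (kron 3 B C))"
    using abs_distinct_kron[OF assms(1) BC] by simp
  then show ?thesis
    using abs_distinct_permute_columns[OF _ bij_shuffle27] by (simp add: magic27_def[abs_def])
qed

lemmas magic9_rot = magic_magic9[OF orth_rows_rot row_col_sums_rot orth_rows_rot row_col_sums_rot]

lemmas magic27_rot =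
  magic_magic27[OF orth_rows_rot row_col_sums_rot orth_rows_rot row_col_sums_rot
    orth_rows_rot row_col_sums_rot]

text \<open>Both matrices open the list of \<open>uniq_243\<close>, whose initial segment inherits
  uniqueness. The quaternions have norms 57 and 95, with product 5415.\<close>

lemma proper_order_9: "\<exists>M. proper_euler_magic 9 29322225 M"
proof -
  let ?M = "magic9 (rot 1 2 4 6) (rot 1 3 6 7)"
  have "magic 9 29322225 ?M"
    using magic9_rot[of 1 2 4 6 1 3 6 7] by simp
  moreover have "abs_distinct 9 ?M"
    using uniq_appendD(1)[of "[vals 3 (rot 1 2 4 6), vals 3 (rot 1 3 6 7)]"] uniq_243
    by (intro abs_distinct_magic9 abs_distinct_entries)
       (simp_all add: entries_1_2_4_6 entries_1_3_6_7 vals_nonempty)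
  ultimately show ?thesis
    using proper_euler_magic_mat by fastforce
qed

lemma proper_order_27: "\<exists>M. proper_euler_magic 27 544710422025 M"
proof -
  let ?M = "magic27 (rot 1 3 5 6) (rot 1 3 5 8) (rot 2 4 6 7)"
  \<comment> \<open>The quaternions have norms 71, 99 and 105, with product 738045.\<close>
  have "magic 27 544710422025 ?M"
    using magic27_rot[of 1 3 5 6 1 3 5 8 2 4 6 7] by simp
  moreover have "abs_distinct 27 ?M"
    using uniq_27
    by (intro abs_distinct_magic27 abs_distinct_entries)
       (simp_all add: entries_1_3_5_6 entries_1_3_5_8 entries_2_4_6_7)
  ultimately show ?thesis
    using proper_euler_magic_mat by fastforce
qed

text \<open>Uniqueness for all four sets yields uniqueness within each pair and between the two
  arrays of order 9. The norms 105, 131, 147 and 171 multiply to 345759435.\<close>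

lemma proper_order_81: "\<exists>M. proper_euler_magic 81 119549586891519225 M"
proof -
  let ?A = "magic9 (rot 1 2 6 8) (rot 3 4 5 9)" and ?B = "magic9 (rot 1 3 4 11) (rot 3 4 5 11)"
  let ?Ss = "[vals 3 (rot 1 2 6 8), vals 3 (rot 3 4 5 9)]"
  let ?Ts = "[vals 3 (rot 1 3 4 11), vals 3 (rot 3 4 5 11)]"
  have uniq: "uniq (?Ss @ ?Ts)" "uniq ?Ss" "uniq ?Ts"
    using uniq_81 uniq_appendD[of ?Ss ?Ts] by (simp_all add: vals_nonempty)
  have "magic (9 * 9) 119549586891519225 (kron 9 ?A ?B)"
    using magic_kron[OF magic9_rot[of 1 2 6 8 3 4 5 9] magic9_rot[of 1 3 4 11 3 4 5 11]] by simp
  moreover have "abs_distinct (9 * 9) (kron 9 ?A ?B)"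
    by (intro abs_distinct_kron abs_distinct_magic9 abs_distinct_entries uniq
          unique_mult_mono[OF unique_mult_prods[OF uniq(1)] vals_magic9 vals_magic9])
       (simp_all add: entries_1_2_6_8 entries_3_4_5_9 entries_1_3_4_11 entries_3_4_5_11)
  ultimately show ?thesis
    using proper_euler_magic_mat[of "9 * 9"] by fastforce
qed

text \<open>An array of order 9 is combined with one of order 27. The norms 57, 95, 147, 231 and 447
  multiply to 82193088285.\<close>

lemma proper_order_243: "\<exists>M. proper_euler_magic 243 6755703761825804241225 M"
proof -
  let ?A = "magic9 (rot 1 2 4 6) (rot 1 3 6 7)"
  let ?B = "magic27 (rot 3 5 7 8) (rot 1 3 5 14) (rot 1 9 13 14)"
  let ?Ss = "[vals 3 (rot 1 2 4 6), vals 3 (rot 1 3 6 7)]"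
  let ?Ts = "[vals 3 (rot 3 5 7 8), vals 3 (rot 1 3 5 14), vals 3 (rot 1 9 13 14)]"
  have uniq: "uniq (?Ss @ ?Ts)" "uniq ?Ss" "uniq ?Ts"
    using uniq_243 uniq_appendD[of ?Ss ?Ts] by (simp_all add: vals_nonempty)
  have "magic (9 * 27) 6755703761825804241225 (kron 27 ?A ?B)"
    using magic_kron[OF magic9_rot[of 1 2 4 6 1 3 6 7] magic27_rot[of 3 5 7 8 1 3 5 14 1 9 13 14]]
    by simp
  moreover have "abs_distinct (9 * 27) (kron 27 ?A ?B)"
    by (intro abs_distinct_kron abs_distinct_magic9 abs_distinct_magic27 abs_distinct_entries uniq
          unique_mult_mono[OF unique_mult_prods[OF uniq(1)] vals_magic9 vals_magic27])
       (simp_all add: entries_1_2_4_6 entries_1_3_6_7 entries_3_5_7_8 entries_1_3_5_14 entries_1_9_13_14)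
  ultimately show ?thesis
    using proper_euler_magic_mat[of "9 * 27"] by fastforce
qed

theorem theorem5p1:
  shows "((\<exists>M. proper_euler_magic 9 29322225 M) \<and> (29322225 :: int) = 5415\<^sup>2) \<and>
    ((\<exists>M. proper_euler_magic 27 544710422025 M) \<and> (544710422025 :: int) = 738045\<^sup>2) \<and>
    ((\<exists>M. proper_euler_magic 81 119549586891519225 M) \<and>
      (119549586891519225 :: int) = 345759435\<^sup>2) \<and>
    ((\<exists>M. proper_euler_magic 243 6755703761825804241225 M) \<and>
      (6755703761825804241225 :: int) = 82193088285\<^sup>2)"
  using proper_order_9 proper_order_27 proper_order_81 proper_order_243 by simp

end
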